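(* Let $V$ be a finite vocabulary, let $\gamma\in(0,1)$ be such that $\gamma|V|$ is an integer, let $\delta>0$, and let $G\subset V$ be the green list, a subset of size $\gamma|V|$ (chosen uniformly at random, independently of the next-token probability vector). Suppose the next-token probability vector $\boldsymbol{\sigma}=(\sigma_v)_{v\in V}$ is distributed according to the uniform Dirichlet distribution $\mathrm{Dir}(1,\ldots,1)$ on the probability simplex $\Delta^{|V|-1}$. Let $\gamma' := \mathbb{P}_\delta(x\in G)$ be the marginal probability (averaged over $\boldsymbol{\sigma}$) that a token $x$ sampled from the watermarked distribution lies in the green list. Then $$\gamma' = e^{\delta}\gamma\; {}_2F_1\!\left(1,\ \gamma|V|+1;\ |V|+1;\ -(e^{\delta}-1)\right),$$ where ${}_2F_1$ is the Gaussian hypergeometric function. Moreover, in the large-vocabulary regime ($|V|\to\infty$ with $\gamma$ and $\delta$ fixed), $$\gamma' = \frac{e^{\delta}\gamma}{1+\gamma(e^{\delta}-1)} + O(|V|^{-1/2}).$$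
   Context: Watermarked sampling (KGW scheme): given a next-token probability vector $\boldsymbol{\sigma}\in\Delta^{|V|-1}=\{p\in\mathbb{R}^V: p_k\ge 0,\ \sum_k p_k=1\}$ and a green list $G\subset V$, the watermark adds $\delta$ to the logits of the tokens in $G$, so that the watermarked token $x$ has conditional law $$\mathbb{P}_\delta(x=v\mid \boldsymbol{\sigma},G)=\frac{e^{\delta \mathbf{1}\{v\in G\}}\sigma_v}{\sum_{u\in V} e^{\delta \mathbf{1}\{u\in G\}}\sigma_u},\qquad v\in V.$$ The marginal probability is $\mathbb{P}_\delta(x\in G)=\mathbb{E}\big[\sum_{v\in G}\mathbb{P}_\delta(x=v\mid\boldsymbol{\sigma},G)\big]$. The hypergeometric function ${}_2F_1(a,b;c;z)$ for real $z<1$ and $c>b>0$ is understood via its analytic continuation, equivalently Euler's integral ${}_2F_1(a,b;c;z)=\frac{1}{\mathrm{B}(b,c-b)}\int_0^1 t^{b-1}(1-t)^{c-b-1}(1-zt)^{-a}\,dt$, where $\mathrm{B}$ is the Beta function. *)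

theory Defs
  imports "HOL-Probability.Probability" "HOL-Library.Landau_Symbols"
begin

text \<open>
  The density of \<open>Dir(\<alpha>)\<close> with respect to Lebesgue measure in all but one of the coordinates.
  It is taken to be 0 on the boundary of the simplex, a null set, because \<open>0 powr 0 = 0\<close>.
\<close>

definition dirichlet_density :: "'a set \<Rightarrow> ('a \<Rightarrow> real) \<Rightarrow> ('a \<Rightarrow> real) \<Rightarrow> real" where
  "dirichlet_density V \<alpha> p =
     (if \<forall>v\<in>V. 0 < p v
      then Gamma (\<Sum>v\<in>V. \<alpha> v) / (\<Prod>v\<in>V. Gamma (\<alpha> v)) * (\<Prod>v\<in>V. p v powr (\<alpha> v - 1))
      else 0)"

definition simplex_point :: "'a set \<Rightarrow> 'a \<Rightarrow> ('a \<Rightarrow> real) \<Rightarrow> 'a \<Rightarrow> real" where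
  "simplex_point V w p = p(w := 1 - (\<Sum>v\<in>V - {w}. p v))"

text \<open>
  The simplex over \<open>V\<close> is parametrised by the coordinates other than a reference coordinate \<open>w\<close>.
  Changing \<open>w\<close> is an affine change of coordinates with Jacobian of absolute value 1, so the
  resulting measure does not depend on the choice of \<open>w\<close>.
\<close>

definition dirichlet :: "'a set \<Rightarrow> ('a \<Rightarrow> real) \<Rightarrow> ('a \<Rightarrow> real) measure" where
  "dirichlet V \<alpha> =
     (let w = (SOME w. w \<in> V) in
      distr
        (density (\<Pi>\<^sub>M v\<in>V - {w}. lborel)
          (\<lambda>p. ennreal (dirichlet_density V \<alpha> (simplex_point V w p))))
        (\<Pi>\<^sub>M v\<in>V. borel)
        (simplex_point V w))"

definition watermark_prob :: "'a set \<Rightarrow> real \<Rightarrow> ('a \<Rightarrow> real) \<Rightarrow> 'a set \<Rightarrow> 'a \<Rightarrow> real" where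
  "watermark_prob V \<delta> \<sigma> G v =
     exp (\<delta> * indicator G v) * \<sigma> v / (\<Sum>u\<in>V. exp (\<delta> * indicator G u) * \<sigma> u)"

definition green_lists :: "'a set \<Rightarrow> real \<Rightarrow> 'a set set" where
  "green_lists V \<gamma> = {G. G \<subseteq> V \<and> real (card G) = \<gamma> * real (card V)}"

text \<open>
  The joint law of \<open>(\<sigma>, G, x)\<close>: \<open>\<sigma>\<close> and \<open>G\<close> are independent, and given \<open>(\<sigma>, G)\<close> the token \<open>x\<close>
  has probability mass function \<open>watermark_prob V \<delta> \<sigma> G\<close>, i.e. this is its conditional density
  with respect to counting measure on \<open>V\<close>.
\<close>

definition watermark_law ::
    "'a set \<Rightarrow> real \<Rightarrow> real \<Rightarrow> (('a \<Rightarrow> real) \<times> 'a set \<times> 'a) measure" where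
  "watermark_law V \<gamma> \<delta> =
     density
       (dirichlet V (\<lambda>_. 1) \<Otimes>\<^sub>M (uniform_count_measure (green_lists V \<gamma>) \<Otimes>\<^sub>M count_space V))
       (\<lambda>(\<sigma>, G, x). ennreal (watermark_prob V \<delta> \<sigma> G x))"

definition green_prob :: "'a set \<Rightarrow> real \<Rightarrow> real \<Rightarrow> real" where
  "green_prob V \<gamma> \<delta> =
     measure (watermark_law V \<gamma> \<delta>)
       {(\<sigma>, G, x) \<in> space (watermark_law V \<gamma> \<delta>). x \<in> G}"

text \<open>
  Euler's integral; meaningful for \<open>0 < b < c\<close> and \<open>z < 1\<close>, where it agrees with the analytic
  continuation of the hypergeometric series.
\<close>

definition hyp2F1 :: "real \<Rightarrow> real \<Rightarrow> real \<Rightarrow> real \<Rightarrow> real" where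
  "hyp2F1 a b c z =
     1 / Beta b (c - b) *
     integral {0..1} (\<lambda>t. t powr (b - 1) * (1 - t) powr (c - b - 1) * (1 - z * t) powr (- a))"


lemma sets_dirichlet [measurable_cong]: "sets (dirichlet V \<alpha>) = sets (\<Pi>\<^sub>M v\<in>V. borel)"
  by (simp add: dirichlet_def Let_def)

lemma finite_green_lists: "finite V \<Longrightarrow> finite (green_lists V \<gamma>)"
  by (rule finite_subset [of _ "Pow V"]) (auto simp: green_lists_def)

lemma sets_green_lists_tokens:
  assumes "finite V"
  shows "sets (uniform_count_measure (green_lists V \<gamma>) \<Otimes>\<^sub>M count_space V) =
         sets (count_space (green_lists V \<gamma> \<times> V))"
proof -
  have "sets (uniform_count_measure (green_lists V \<gamma>) \<Otimes>\<^sub>M count_space V) =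
      sets (count_space (green_lists V \<gamma>) \<Otimes>\<^sub>M count_space V)"
    by (rule sets_pair_measure_cong) (auto simp: sets_uniform_count_measure)
  also have "\<dots> = sets (count_space (green_lists V \<gamma> \<times> V))"
    using assms finite_green_lists by (subst pair_measure_count_space) auto
  finally show ?thesis .
qed

lemma measurable_watermark_prob:
  assumes "finite V"
  shows "(\<lambda>(\<sigma>, G, x). watermark_prob V \<delta> \<sigma> G x)
           \<in> borel_measurable
               (dirichlet V \<alpha> \<Otimes>\<^sub>M (uniform_count_measure (green_lists V \<gamma>) \<Otimes>\<^sub>M count_space V))"
    (is "?f \<in> borel_measurable (?D \<Otimes>\<^sub>M (?U \<Otimes>\<^sub>M ?C))")
proof -
  have meas: "sets (?D \<Otimes>\<^sub>M (?U \<Otimes>\<^sub>M ?C)) =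
      sets ((\<Pi>\<^sub>M v\<in>V. borel) \<Otimes>\<^sub>M count_space (green_lists V \<gamma> \<times> V))"
    by (rule sets_pair_measure_cong[OF sets_dirichlet sets_green_lists_tokens[OF assms]])
  have "(\<lambda>p. ?f (fst p, snd p))
      \<in> borel_measurable ((\<Pi>\<^sub>M v\<in>V. borel) \<Otimes>\<^sub>M count_space (green_lists V \<gamma> \<times> V))"
  proof (rule measurable_compose_countable'[where f = "\<lambda>y p. ?f (fst p, y)" and g = snd
        and I = "green_lists V \<gamma> \<times> V"])
    fix y assume y: "y \<in> green_lists V \<gamma> \<times> V"
    have comp: "(\<lambda>\<sigma>. \<sigma> v) \<in> borel_measurable (\<Pi>\<^sub>M v\<in>V. borel)" if "v \<in> V" for v
      using that by (rule measurable_component_singleton)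
    obtain G x where yGx: "y = (G, x)" and x: "x \<in> V"
      using y by auto
    have "(\<lambda>\<sigma>. watermark_prob V \<delta> \<sigma> G x) \<in> borel_measurable (\<Pi>\<^sub>M v\<in>V. borel)"
      unfolding watermark_prob_def
      by (intro borel_measurable_divide borel_measurable_times borel_measurable_sum
          borel_measurable_const comp x)
    hence "(\<lambda>p. watermark_prob V \<delta> (fst p) G x) \<in> borel_measurable
        ((\<Pi>\<^sub>M v\<in>V. borel) \<Otimes>\<^sub>M count_space (green_lists V \<gamma> \<times> V))"
      by (rule measurable_compose[OF measurable_fst])
    thus "(\<lambda>p. ?f (fst p, y)) \<in> borel_measurable
        ((\<Pi>\<^sub>M v\<in>V. borel) \<Otimes>\<^sub>M count_space (green_lists V \<gamma> \<times> V))"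
      by (simp add: yGx)
  next
    show "countable (green_lists V \<gamma> \<times> V)"
      using assms finite_green_lists by (intro countable_finite) auto
  qed (rule measurable_snd)
  hence "?f \<in> borel_measurable ((\<Pi>\<^sub>M v\<in>V. borel) \<Otimes>\<^sub>M count_space (green_lists V \<gamma> \<times> V))"
    by simp
  thus ?thesis
    by (simp add: measurable_cong_sets[OF meas refl])
qed


lemma measurable_simplex_point:
  "w \<in> V \<Longrightarrow> simplex_point V w \<in> (\<Pi>\<^sub>M v\<in>V - {w}. lborel) \<rightarrow>\<^sub>M (\<Pi>\<^sub>M v\<in>V. borel)"
proof (rule measurable_PiM_single')
  fix v assume w: "w \<in> V" and v: "v \<in> V"
  have comp: "(\<lambda>p. p u :: real) \<in> borel_measurable (\<Pi>\<^sub>M v\<in>V - {w}. lborel)" if "u \<in> V - {w}" for u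
    using measurable_component_singleton[OF that, of "\<lambda>_. lborel :: real measure"] by simp
  show "(\<lambda>p. simplex_point V w p v) \<in> borel_measurable (\<Pi>\<^sub>M v\<in>V - {w}. lborel)"
  proof (cases "v = w")
    case True
    have "(\<lambda>p. 1 - (\<Sum>u\<in>V - {w}. p u :: real)) \<in> borel_measurable (\<Pi>\<^sub>M v\<in>V - {w}. lborel)"
      by (intro borel_measurable_diff borel_measurable_const borel_measurable_sum comp)
    thus ?thesis
      using True by (simp add: simplex_point_def)
  next
    case False
    thus ?thesis
      using comp[of v] v by (simp add: simplex_point_def)
  qed
qed (auto simp: simplex_point_def space_PiM PiE_iff extensional_def)

lemma measurable_dirichlet_density:
  "finite V \<Longrightarrow> dirichlet_density V \<alpha> \<in> borel_measurable (\<Pi>\<^sub>M v\<in>V. borel)"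
proof -
  assume fin: "finite V"
  have comp [measurable]: "(\<lambda>p. p u) \<in> borel_measurable (\<Pi>\<^sub>M v\<in>V. (borel :: real measure))"
    if "u \<in> V" for u
    using that by (rule measurable_component_singleton)
  have [measurable]: "Measurable.pred (\<Pi>\<^sub>M v\<in>V. borel) (\<lambda>p. \<forall>v\<in>V. 0 < (p v :: real))"
    using fin by (intro pred_intros_finite borel_measurable_pred_less comp) auto
  have [measurable]: "(\<lambda>p. \<Prod>v\<in>V. p v powr (\<alpha> v - 1)) \<in> borel_measurable (\<Pi>\<^sub>M v\<in>V. borel)"
    by (intro borel_measurable_prod powr_real_measurable comp) auto
  show ?thesis
    unfolding dirichlet_density_def by measurable
qed

lemma AE_dirichlet_pos:
  assumes "finite V" "V \<noteq> {}"
  shows "AE \<sigma> in dirichlet V \<alpha>. \<forall>v\<in>V. 0 < \<sigma> v"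
proof -
  define w where "w = (SOME w. w \<in> V)"
  have w: "w \<in> V"
    using assms(2) by (simp add: w_def some_in_eq)
  let ?L = "\<Pi>\<^sub>M v\<in>V - {w}. (lborel :: real measure)"
  have sp [measurable]: "simplex_point V w \<in> ?L \<rightarrow>\<^sub>M (\<Pi>\<^sub>M v\<in>V. borel)"
    using w by (rule measurable_simplex_point)
  have [measurable]: "dirichlet_density V \<alpha> \<in> borel_measurable (\<Pi>\<^sub>M v\<in>V. borel)"
    using assms(1) by (rule measurable_dirichlet_density)
  have comp: "(\<lambda>p. p u) \<in> borel_measurable (\<Pi>\<^sub>M v\<in>V. (borel :: real measure))" if "u \<in> V" for u
    using that by (rule measurable_component_singleton)
  have [measurable]: "Measurable.pred (\<Pi>\<^sub>M v\<in>V. borel) (\<lambda>p. \<forall>v\<in>V. 0 < (p v :: real))"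
    using assms by (intro pred_intros_finite borel_measurable_pred_less comp) auto
  show ?thesis
    unfolding dirichlet_def Let_def w_def[symmetric]
    by (subst AE_distr_iff) (auto simp: AE_density dirichlet_density_def)
qed


lemma green_prob_eq_expectation:
  assumes "finite V" "V \<noteq> {}"
  shows "green_prob V \<gamma> \<delta> =
    (\<integral>\<sigma>. (\<integral>G. (\<Sum>v\<in>G. watermark_prob V \<delta> \<sigma> G v) \<partial>uniform_count_measure (green_lists V \<gamma>))
       \<partial>dirichlet V (\<lambda>_. 1))"
proof -
  let ?D = "dirichlet V (\<lambda>_. 1)" and ?C = "count_space V"
  let ?A = "green_lists V \<gamma>"
  let ?U = "uniform_count_measure ?A"
  let ?M = "?D \<Otimes>\<^sub>M (?U \<Otimes>\<^sub>M ?C)"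
  let ?f = "\<lambda>\<sigma> G x. ennreal (watermark_prob V \<delta> \<sigma> G x)"
  let ?g = "\<lambda>\<sigma> G x. ?f \<sigma> G x * indicator G x"
  let ?E = "{(\<sigma>, G, x) \<in> space ?M. x \<in> G}"
  have finA: "finite ?A"
    using assms(1) by (rule finite_green_lists)
  have sub: "G \<subseteq> V" if "G \<in> ?A" for G
    using that by (simp add: green_lists_def)
  interpret U: finite_measure ?U
    by (rule finite_measureI)
       (use finA in \<open>simp add: space_uniform_count_measure emeasure_uniform_count_measure\<close>)
  interpret C: finite_measure ?C
    using assms(1) by (rule finite_measure_count_space)
  interpret UC: sigma_finite_measure "?U \<Otimes>\<^sub>M ?C"
    by (rule sigma_finite_pair_measure) unfold_locales
  have UC: "sets (?U \<Otimes>\<^sub>M ?C) = Pow (?A \<times> V)"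
    using sets_green_lists_tokens[OF assms(1)] by simp
  have f [measurable]: "(\<lambda>(\<sigma>, G, x). ?f \<sigma> G x) \<in> borel_measurable ?M"
    using measurable_compose[OF measurable_watermark_prob[OF assms(1)] measurable_ennreal]
    by (simp add: case_prod_beta)
  have "{p \<in> space (?U \<Otimes>\<^sub>M ?C). snd p \<in> fst p} \<in> sets (?U \<Otimes>\<^sub>M ?C)"
    by (auto simp: UC space_pair_measure space_uniform_count_measure)
  hence "snd -` {p \<in> space (?U \<Otimes>\<^sub>M ?C). snd p \<in> fst p} \<inter> space ?M \<in> sets ?M"
    by (rule measurable_sets[OF measurable_snd])
  also have "snd -` {p \<in> space (?U \<Otimes>\<^sub>M ?C). snd p \<in> fst p} \<inter> space ?M = ?E"
    by (auto simp: space_pair_measure)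
  finally have E [measurable]: "?E \<in> sets ?M" .
  have g_eq: "?f \<sigma> G x * indicator ?E (\<sigma>, G, x) = ?g \<sigma> G x" if "(\<sigma>, G, x) \<in> space ?M" for \<sigma> G x
    using that by (auto simp: indicator_def)
  have g [measurable]: "(\<lambda>(\<sigma>, G, x). ?g \<sigma> G x) \<in> borel_measurable ?M"
  proof -
    have "(\<lambda>p. (case p of (\<sigma>, G, x) \<Rightarrow> ?f \<sigma> G x) * indicator ?E p) \<in> borel_measurable ?M"
      by measurable
    thus ?thesis
      by (rule measurable_cong[THEN iffD1, rotated]) (auto simp: g_eq)
  qed
  have inner: "(\<integral>\<^sup>+p. (case p of (G, x) \<Rightarrow> h G x) \<partial>(?U \<Otimes>\<^sub>M ?C)) =
      (\<Sum>G\<in>?A. ennreal (1 / card ?A) * (\<Sum>x\<in>V. h G x))" for h :: "'a set \<Rightarrow> 'a \<Rightarrow> ennreal"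
  proof -
    have "(\<lambda>(G, x). h G x) \<in> borel_measurable (?U \<Otimes>\<^sub>M ?C)"
      by (rule measurableI) (auto simp: UC space_pair_measure space_uniform_count_measure)
    from C.nn_integral_fst[OF this] show ?thesis
      using finA assms(1)
      by (simp add: uniform_count_measure_def nn_integral_point_measure_finite
          nn_integral_count_space_finite)
  qed
  have "emeasure (watermark_law V \<gamma> \<delta>) ?E = (\<integral>\<^sup>+p. (case p of (\<sigma>, G, x) \<Rightarrow> ?f \<sigma> G x) * indicator ?E p \<partial>?M)"
    unfolding watermark_law_def by (rule emeasure_density) measurable
  also have "\<dots> = (\<integral>\<^sup>+p. (case p of (\<sigma>, G, x) \<Rightarrow> ?g \<sigma> G x) \<partial>?M)"
    by (rule nn_integral_cong) (auto simp: g_eq)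
  also have "\<dots> = (\<integral>\<^sup>+\<sigma>. \<integral>\<^sup>+p. (case p of (G, x) \<Rightarrow> ?g \<sigma> G x) \<partial>(?U \<Otimes>\<^sub>M ?C) \<partial>?D)"
    using UC.nn_integral_fst[OF g] by simp
  also have "\<dots> = (\<integral>\<^sup>+\<sigma>. (\<Sum>G\<in>?A. ennreal (1 / card ?A) * (\<Sum>x\<in>V. ?g \<sigma> G x)) \<partial>?D)"
    by (simp add: inner)
  also have "\<dots> = (\<integral>\<^sup>+\<sigma>. ennreal (\<integral>G. (\<Sum>v\<in>G. watermark_prob V \<delta> \<sigma> G v) \<partial>?U) \<partial>?D)"
  proof (rule nn_integral_cong_AE, use AE_dirichlet_pos[OF assms, of "\<lambda>_. 1"] in eventually_elim)
    fix \<sigma> :: "'a \<Rightarrow> real" assume pos: "\<forall>v\<in>V. 0 < \<sigma> v"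
    have nn: "0 \<le> watermark_prob V \<delta> \<sigma> G v" if "v \<in> V" for G v
      using pos that unfolding watermark_prob_def
      by (intro divide_nonneg_nonneg sum_nonneg mult_nonneg_nonneg) (auto intro: less_imp_le)
    have "(\<Sum>x\<in>V. ?g \<sigma> G x) = ennreal (\<Sum>v\<in>G. watermark_prob V \<delta> \<sigma> G v)" if "G \<in> ?A" for G
    proof -
      have "(\<Sum>x\<in>V. ?g \<sigma> G x) = (\<Sum>x\<in>G. ?f \<sigma> G x)"
        using assms(1) sub[OF that] by (intro sum.mono_neutral_cong_right) auto
      also have "\<dots> = ennreal (\<Sum>v\<in>G. watermark_prob V \<delta> \<sigma> G v)"
        using sub[OF that] by (intro sum_ennreal nn) auto
      finally show ?thesis .
    qed
    hence "(\<Sum>G\<in>?A. ennreal (1 / card ?A) * (\<Sum>x\<in>V. ?g \<sigma> G x)) =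
        (\<Sum>G\<in>?A. ennreal (1 / card ?A * (\<Sum>v\<in>G. watermark_prob V \<delta> \<sigma> G v)))"
      by (intro sum.cong refl) (simp add: ennreal_mult' [symmetric])
    also have "\<dots> = ennreal (\<Sum>G\<in>?A. 1 / card ?A * (\<Sum>v\<in>G. watermark_prob V \<delta> \<sigma> G v))"
      using sub by (intro sum_ennreal mult_nonneg_nonneg sum_nonneg nn) auto
    finally show "(\<Sum>G\<in>?A. ennreal (1 / card ?A) * (\<Sum>x\<in>V. ?g \<sigma> G x)) =
        ennreal (\<integral>G. (\<Sum>v\<in>G. watermark_prob V \<delta> \<sigma> G v) \<partial>?U)"
      using finA by (simp add: integral_uniform_count_measure sum_divide_distrib)
  qed
  finally have em: "emeasure (watermark_law V \<gamma> \<delta>) ?E =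
      (\<integral>\<^sup>+\<sigma>. ennreal (\<integral>G. (\<Sum>v\<in>G. watermark_prob V \<delta> \<sigma> G v) \<partial>?U) \<partial>?D)" .
  have meas: "(\<lambda>\<sigma>. \<integral>G. (\<Sum>v\<in>G. watermark_prob V \<delta> \<sigma> G v) \<partial>?U) \<in> borel_measurable ?D"
  proof -
    have comp: "(\<lambda>\<sigma>. \<sigma> v) \<in> borel_measurable ?D" if "v \<in> V" for v
      using measurable_component_singleton[OF that, of "\<lambda>_. borel :: real measure"]
      by (simp add: measurable_cong_sets[OF sets_dirichlet refl])
    have "(\<lambda>\<sigma>. watermark_prob V \<delta> \<sigma> G x) \<in> borel_measurable ?D" if "x \<in> V" for G x
      unfolding watermark_prob_def
      by (intro borel_measurable_divide borel_measurable_times borel_measurable_sum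
          borel_measurable_const comp that)
    thus ?thesis
      using finA sub
      by (auto simp: integral_uniform_count_measure
          intro!: borel_measurable_divide borel_measurable_sum)
  qed
  have "AE \<sigma> in ?D. 0 \<le> (\<integral>G. (\<Sum>v\<in>G. watermark_prob V \<delta> \<sigma> G v) \<partial>?U)"
    using AE_dirichlet_pos[OF assms, of "\<lambda>_. 1"]
  proof eventually_elim
    fix \<sigma> :: "'a \<Rightarrow> real" assume pos: "\<forall>v\<in>V. 0 < \<sigma> v"
    have "0 \<le> watermark_prob V \<delta> \<sigma> G v" if "v \<in> V" for G v
      using pos that unfolding watermark_prob_def
      by (intro divide_nonneg_nonneg sum_nonneg mult_nonneg_nonneg) (auto intro: less_imp_le)
    thus "0 \<le> (\<integral>G. (\<Sum>v\<in>G. watermark_prob V \<delta> \<sigma> G v) \<partial>?U)"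
      using finA sub
      by (auto simp: integral_uniform_count_measure intro!: divide_nonneg_nonneg sum_nonneg)
  qed
  from integral_eq_nn_integral[OF meas this] show ?thesis
    by (simp add: green_prob_def measure_def em[symmetric] watermark_law_def)
qed

end

theory Submission
  imports Defs
begin

text \<open>
  Only the green mass \<open>S = (\<Sum>v\<in>G. \<sigma> v)\<close> of the probability vector matters: the watermarked token
  is green with conditional probability \<open>exp \<delta> * S / (1 + (exp \<delta> - 1) * S)\<close>. Under the uniform
  Dirichlet distribution \<open>S\<close> has the law \<open>Beta(\<gamma>n, (1 - \<gamma>)n)\<close>, where \<open>n = card V\<close>, whatever \<open>G\<close> is;
  integrating against the Beta density gives Euler's integral. The conditional probability is
  \<open>exp \<delta>\<close>-Lipschitz in \<open>S\<close>, and \<open>S\<close> has mean \<open>\<gamma>\<close> and variance at most \<open>1/n\<close>, so the average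
  is within \<open>exp \<delta> / sqrt n\<close> of its value at \<open>S = \<gamma>\<close>.
\<close>

section \<open>Volumes of corner simplices and sums over the positive orthant\<close>

lemma nn_integral_power_Ioo:
  assumes "0 < t"
  shows "(\<integral>\<^sup>+y. ennreal ((t - y) ^ m / fact m) * indicator {0<..<t} y \<partial>lborel) =
         ennreal (t ^ Suc m / fact (Suc m))"
proof -
  let ?F = "\<lambda>y. - ((t - y) ^ Suc m / fact (Suc m))"
  \<comment> \<open>The endpoints are null, so the fundamental theorem of calculus can be applied on
    the closed interval.\<close>
  have "(\<integral>\<^sup>+y. ennreal ((t - y) ^ m / fact m) * indicator {0<..<t} y \<partial>lborel) =
      (\<integral>\<^sup>+y. ennreal ((t - y) ^ m / fact m) * indicator {0..t} y \<partial>lborel)"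
    by (rule nn_integral_cong_AE)
      (use AE_lborel_singleton[of "0::real"] AE_lborel_singleton[of t] in eventually_elim,
        auto simp: indicator_def)
  also have "\<dots> = ?F t - ?F 0"
  proof (rule nn_integral_FTC_Icc)
    fix y assume "y \<in> {0..t}"
    have "(?F has_real_derivative - (real (Suc m) * (t - y) ^ m * (- 1) / fact (Suc m))) (at y)"
      by (rule derivative_eq_intros refl | simp)+
    thus "(?F has_real_derivative (t - y) ^ m / fact m) (at y)"
      by (simp add: field_simps del: of_nat_Suc)
    show "0 \<le> (t - y) ^ m / fact m"
      using \<open>y \<in> {0..t}\<close> by simp
  qed (use assms in auto)
  finally show ?thesis
    by simp
qed

interpretation lborel_PiM: product_sigma_finite "\<lambda>_. lborel :: real measure"
  by standard

text \<open>Summing \<open>n\<close> coordinates pushes Lebesgue measure on the positive orthant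
  forward to the \<open>n\<close>-fold convolution of \<open>indicator {0<..}\<close> with itself,
  whose density is \<open>s ^ (n - 1) / fact (n - 1)\<close>. The induction adds one coordinate,
  that is, one more convolution factor. For empty \<open>A\<close> the sum would be a point mass at
  0, without density.\<close>

lemma nn_integral_pos_orthant_sum:
  fixes h :: "real \<Rightarrow> ennreal"
  assumes "finite A" "A \<noteq> {}" and "h \<in> borel_measurable borel"
  shows "(\<integral>\<^sup>+p. h (\<Sum>v\<in>A. p v) * (\<Prod>v\<in>A. indicator {0<..} (p v)) \<partial>(\<Pi>\<^sub>M v\<in>A. lborel)) =
         (\<integral>\<^sup>+s. h s * (ennreal (s ^ (card A - 1) / fact (card A - 1)) * indicator {0<..} s) \<partial>lborel)"
  using assms
proof (induction A arbitrary: h rule: finite_ne_induct)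
  case (singleton w)
  note [measurable] = singleton
  show ?case
    using lborel_PiM.product_nn_integral_singleton[of "\<lambda>x. h x * indicator {0<..} x" w]
    by simp
next
  case (insert w A)
  note [measurable] = insert.prems
  define m where "m = card A - 1"
  have card: "card (insert w A) - 1 = Suc m"
    using insert.hyps by (simp add: m_def card_gt_0_iff)
  let ?I = "\<lambda>x. indicator {0<..} x :: ennreal"
  let ?P = "\<lambda>s. ennreal (s ^ m / fact m)"
  have "(\<integral>\<^sup>+p. h (\<Sum>v\<in>insert w A. p v) * (\<Prod>v\<in>insert w A. ?I (p v)) \<partial>(\<Pi>\<^sub>M v\<in>insert w A. lborel)) =
      (\<integral>\<^sup>+y. \<integral>\<^sup>+p. h (\<Sum>v\<in>insert w A. (p(w := y)) v) * (\<Prod>v\<in>insert w A. ?I ((p(w := y)) v))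
        \<partial>(\<Pi>\<^sub>M v\<in>A. lborel) \<partial>lborel)"
    using insert.hyps by (intro lborel_PiM.product_nn_integral_insert_rev) measurable
  also have "\<dots> = (\<integral>\<^sup>+y. \<integral>\<^sup>+p. ?I y * (h (y + (\<Sum>v\<in>A. p v)) * (\<Prod>v\<in>A. ?I (p v)))
        \<partial>(\<Pi>\<^sub>M v\<in>A. lborel) \<partial>lborel)"
  proof (intro nn_integral_cong)
    fix y :: real and p :: "'a \<Rightarrow> real"
    have "(\<Sum>v\<in>A. (p(w := y)) v) = (\<Sum>v\<in>A. p v)"
      using insert.hyps by (intro sum.cong) auto
    moreover have "(\<Prod>v\<in>A. ?I ((p(w := y)) v)) = (\<Prod>v\<in>A. ?I (p v))"
      using insert.hyps by (intro prod.cong) auto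
    ultimately show "h (\<Sum>v\<in>insert w A. (p(w := y)) v) * (\<Prod>v\<in>insert w A. ?I ((p(w := y)) v)) =
        ?I y * (h (y + (\<Sum>v\<in>A. p v)) * (\<Prod>v\<in>A. ?I (p v)))"
      using insert.hyps by (simp add: mult_ac)
  qed
  also have "\<dots> = (\<integral>\<^sup>+y. ?I y * (\<integral>\<^sup>+p. h (y + (\<Sum>v\<in>A. p v)) * (\<Prod>v\<in>A. ?I (p v))
        \<partial>(\<Pi>\<^sub>M v\<in>A. lborel)) \<partial>lborel)"
    by (intro nn_integral_cong nn_integral_cmult) measurable
  \<comment> \<open>The induction hypothesis is applied to \<open>h\<close> shifted by the new
    coordinate \<open>y\<close>; this is why \<open>h\<close> is arbitrary in the induction.\<close>
  also have "\<dots> = (\<integral>\<^sup>+y. ?I y * (\<integral>\<^sup>+s. h (y + s) * (?P s * ?I s) \<partial>lborel) \<partial>lborel)"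
    using insert.IH[of "\<lambda>s. h (_ + s)"] by (simp add: m_def)
  also have "\<dots> = (\<integral>\<^sup>+y. ?I y * (\<integral>\<^sup>+t. h t * (?P (t - y) * ?I (t - y)) \<partial>lborel) \<partial>lborel)"
  proof -
    have "(\<integral>\<^sup>+s. h (y + s) * (?P s * ?I s) \<partial>lborel) =
        (\<integral>\<^sup>+t. h t * (?P (t - y) * ?I (t - y)) \<partial>lborel)" for y :: real
      using nn_integral_real_affine[of "\<lambda>t. h t * (?P (t - y) * ?I (t - y))" 1 y] by simp
    thus ?thesis
      by simp
  qed
  also have "\<dots> = (\<integral>\<^sup>+y. \<integral>\<^sup>+t. ?I y * (h t * (?P (t - y) * ?I (t - y))) \<partial>lborel \<partial>lborel)"
    by (intro nn_integral_cong nn_integral_cmult[symmetric]) measurable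
  also have "\<dots> = (\<integral>\<^sup>+t. \<integral>\<^sup>+y. ?I y * (h t * (?P (t - y) * ?I (t - y))) \<partial>lborel \<partial>lborel)"
    by (rule lborel_pair.Fubini') measurable
  \<comment> \<open>The two indicators confine \<open>y\<close> to \<open>{0<..<t}\<close>, which
    leaves a one-dimensional power integral; both sides vanish for \<open>t \<le> 0\<close>.\<close>
  also have "\<dots> = (\<integral>\<^sup>+t. h t * (ennreal (t ^ Suc m / fact (Suc m)) * ?I t) \<partial>lborel)"
  proof (rule nn_integral_cong)
    fix t :: real
    have "(\<integral>\<^sup>+y. ?I y * (h t * (?P (t - y) * ?I (t - y))) \<partial>lborel) =
        (\<integral>\<^sup>+y. h t * (?P (t - y) * indicator {0<..<t} y) \<partial>lborel)"
      by (intro nn_integral_cong) (auto simp: indicator_def)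
    also have "\<dots> = h t * (\<integral>\<^sup>+y. ?P (t - y) * indicator {0<..<t} y \<partial>lborel)"
      by (intro nn_integral_cmult) measurable
    also have "\<dots> = h t * (ennreal (t ^ Suc m / fact (Suc m)) * ?I t)"
    proof (cases "0 < t")
      case True
      thus ?thesis
        using nn_integral_power_Ioo[OF True, of m] by simp
    qed simp
    finally show "(\<integral>\<^sup>+y. ?I y * (h t * (?P (t - y) * ?I (t - y))) \<partial>lborel) =
        h t * (ennreal (t ^ Suc m / fact (Suc m)) * ?I t)" .
  qed
  finally show ?case
    by (simp only: card)
qed

text \<open>The constraint involves only the sum of the coordinates, so the volume reduces to a
  one-dimensional integral. Empty \<open>B\<close> is included, since a set may leave no free
  coordinate besides the pivot; it contributes volume 1 for positive \<open>t\<close>.\<close>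

lemma nn_integral_corner_simplex:
  assumes "finite B"
  shows "(\<integral>\<^sup>+q. indicator {0<..} (t - (\<Sum>v\<in>B. q v)) * (\<Prod>v\<in>B. indicator {0<..} (q v))
           \<partial>(\<Pi>\<^sub>M v\<in>B. lborel)) =
         ennreal (t ^ card B / fact (card B)) * indicator {0<..} t"
proof (cases "B = {}")
  case True
  thus ?thesis
    by (simp add: PiM_empty)
next
  case False
  define m where "m = card B - 1"
  have card: "card B = Suc m"
    using assms False by (simp add: m_def card_gt_0_iff)
  have "(\<integral>\<^sup>+q. indicator {0<..} (t - (\<Sum>v\<in>B. q v)) * (\<Prod>v\<in>B. indicator {0<..} (q v))
           \<partial>(\<Pi>\<^sub>M v\<in>B. lborel)) =
      (\<integral>\<^sup>+s. indicator {0<..} (t - s) * (ennreal (s ^ m / fact m) * indicator {0<..} s) \<partial>lborel)"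
    using nn_integral_pos_orthant_sum[OF assms False, of "\<lambda>s. indicator {0<..} (t - s)"]
    by (simp add: m_def)
  \<comment> \<open>The reflection of \<open>s\<close> to \<open>t - s\<close> brings the integrand
    into the form evaluated by \<open>nn_integral_power_Ioo\<close>.\<close>
  also have "\<dots> = (\<integral>\<^sup>+s. ennreal ((t - s) ^ m / fact m) * indicator {0<..<t} s \<partial>lborel)"
    by (subst nn_integral_real_affine[where c = "- 1" and t = t])
      (auto intro!: nn_integral_cong simp: indicator_def)
  also have "\<dots> = ennreal (t ^ Suc m / fact (Suc m)) * indicator {0<..} t"
  proof (cases "0 < t")
    case True
    thus ?thesis
      using nn_integral_power_Ioo[OF True, of m] by simp
  qed simp
  finally show ?thesis
    by (simp add: card)
qed

section \<open>The Beta law of the mass of a set of tokens\<close>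

text \<open>The cutoff makes this a density on the whole line; the interval is open to match the
  strict positivity in \<open>dirichlet_density\<close>.\<close>

definition beta_density :: "real \<Rightarrow> real \<Rightarrow> real \<Rightarrow> real" where
  "beta_density a b s = indicator {0<..<1} s * (s powr (a - 1) * (1 - s) powr (b - 1)) / Beta a b"

lemma measurable_beta_density [measurable]: "beta_density a b \<in> borel_measurable borel"
  unfolding beta_density_def by measurable

text \<open>With all parameters 1 the density is constant on the open simplex. The indicator is
  written as a product so that it can be split over blocks of coordinates.\<close>

lemma ennreal_dirichlet_density_uniform:
  assumes "finite V"
  shows "ennreal (dirichlet_density V (\<lambda>_. 1) p) =
         ennreal (Gamma (real (card V))) * (\<Prod>v\<in>V. indicator {0<..} (p v))"
proof (cases "\<forall>v\<in>V. 0 < p v")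
  case True
  \<comment> \<open>Positivity matters because \<open>0 powr 0 = 0\<close>; the exponent stays
    \<open>1 - 1\<close> to match the unfolded density.\<close>
  moreover from True have "(\<Prod>v\<in>V. p v powr (1 - 1)) = 1"
    by (intro prod.neutral) force
  ultimately show ?thesis
    by (simp add: dirichlet_density_def del: powr_zero_eq_one diff_self)
next
  case False
  moreover from False have "(\<Prod>v\<in>V. indicator {0<..} (p v)) = (0 :: ennreal)"
    using assms by (intro prod_zero) (auto intro!: bexI)
  ultimately show ?thesis
    by (auto simp: dirichlet_density_def)
qed

text \<open>Gamma at positive integers is a factorial, so the Dirichlet constant, the volume of the
  corner simplex and the density of the sum combine to \<open>1 / Beta\<close> times the two powers.
  In the application \<open>b\<close> counts the free coordinates of the complement, and
  \<open>Suc b\<close> includes the pivot.\<close>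

lemma beta_density_nat:
  assumes "0 < a" and "0 < s"
  shows "ennreal (Gamma (real (a + Suc b))) * (ennreal ((1 - s) ^ b / fact b) * indicator {0<..} (1 - s)) *
           ennreal (s ^ (a - 1) / fact (a - 1)) =
         ennreal (beta_density (real a) (real (Suc b)) s)"
proof (cases "s < 1")
  case True
  have Ga: "Gamma (real a) = fact (a - 1)"
    using Gamma_fact[of "a - 1", where 'a = real] assms(1) by (simp add: of_nat_diff)
  have Gb: "Gamma (real (Suc b)) = fact b"
    using Gamma_fact[of b, where 'a = real] by (simp add: add.commute)
  have "s powr (real a - 1) = s ^ (a - 1)"
    using powr_realpow[of s "a - 1"] assms by (simp add: of_nat_diff)
  moreover have "(1 - s) powr (real (Suc b) - 1) = (1 - s) ^ b"
    using powr_realpow[of "1 - s" b] True by simp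
  ultimately have "Gamma (real (a + Suc b)) * ((1 - s) ^ b / fact b) * (s ^ (a - 1) / fact (a - 1)) =
      beta_density (real a) (real (Suc b)) s"
    using assms True unfolding beta_density_def Beta_def of_nat_add Ga Gb by (simp add: mult_ac)
  moreover have "0 \<le> Gamma (real (a + Suc b))"
    by (intro less_imp_le Gamma_real_pos) simp
  ultimately show ?thesis
    using assms True by (simp add: ennreal_mult[symmetric])
qed (simp add: beta_density_def)

text \<open>
  The pivot \<open>SOME w. w \<in> V\<close> is the coordinate that \<^const>\<open>dirichlet\<close> eliminates. For \<open>A\<close> avoiding it
  the coordinates in \<open>A\<close> are free and those in \<open>V - A\<close> other than the pivot integrate out to the
  volume of a corner simplex; sets containing the pivot are then handled by complement.
\<close>

lemma nn_integral_dirichlet_uniform_subset_sum_off_pivot: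
  fixes h :: "real \<Rightarrow> ennreal"
  assumes "finite V" "A \<subseteq> V" "A \<noteq> {}" and w: "(SOME w. w \<in> V) \<in> V - A"
    and [measurable]: "h \<in> borel_measurable borel"
  shows "(\<integral>\<^sup>+\<sigma>. h (\<Sum>v\<in>A. \<sigma> v) \<partial>dirichlet V (\<lambda>_. 1)) =
         (\<integral>\<^sup>+s. h s * ennreal (beta_density (card A) (card (V - A)) s) \<partial>lborel)"
proof -
  define w where "w = (SOME w. w \<in> V)"
  \<comment> \<open>The coordinates outside \<open>A\<close> that remain free, possibly
    none.\<close>
  define B where "B = V - A - {w}"
  define b where "b = card B"
  let ?I = "\<lambda>x. indicator {0<..} x :: ennreal"
  let ?c = "ennreal (Gamma (real (card V)))"
  let ?L = "\<lambda>A. \<Pi>\<^sub>M v\<in>A. (lborel :: real measure)"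
  have wV: "w \<in> V" "w \<notin> A"
    using w by (auto simp: w_def)
  have AB: "V - {w} = A \<union> B" "A \<inter> B = {}" "V = insert w (A \<union> B)" "w \<notin> A \<union> B" "V - A = insert w B" "w \<notin> B"
    using assms(2) wV by (auto simp: B_def)
  have fin: "finite A" "finite B"
    using assms by (auto simp: B_def intro: finite_subset)
  have cards: "card V = card A + Suc b" "card (V - A) = Suc b" "0 < card A"
    using AB fin assms(3) by (auto simp: b_def card_Un_disjoint card_gt_0_iff)
  have "(\<integral>\<^sup>+\<sigma>. h (\<Sum>v\<in>A. \<sigma> v) \<partial>dirichlet V (\<lambda>_. 1)) =
      (\<integral>\<^sup>+p. ennreal (dirichlet_density V (\<lambda>_. 1) (simplex_point V w p)) *
        h (\<Sum>v\<in>A. simplex_point V w p v) \<partial>?L (V - {w}))"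
  proof -
    have [measurable]: "(\<lambda>\<sigma>. \<Sum>v\<in>A. \<sigma> v) \<in> borel_measurable (\<Pi>\<^sub>M v\<in>V. (borel :: real measure))"
      using assms(2) by (intro borel_measurable_sum measurable_component_singleton) auto
    have [measurable]: "simplex_point V w \<in> ?L (V - {w}) \<rightarrow>\<^sub>M (\<Pi>\<^sub>M v\<in>V. borel)"
      using wV(1) by (rule measurable_simplex_point)
    have [measurable]: "dirichlet_density V (\<lambda>_. 1) \<in> borel_measurable (\<Pi>\<^sub>M v\<in>V. borel)"
      using assms(1) by (rule measurable_dirichlet_density)
    show ?thesis
      unfolding dirichlet_def Let_def w_def[symmetric]
      by (simp add: nn_integral_distr nn_integral_density)
  qed
  also have "\<dots> = (\<integral>\<^sup>+p. ?c * (?I (1 - (\<Sum>v\<in>A. p v) - (\<Sum>v\<in>B. p v)) *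
        ((\<Prod>v\<in>A. ?I (p v)) * (\<Prod>v\<in>B. ?I (p v)))) * h (\<Sum>v\<in>A. p v) \<partial>?L (A \<union> B))"
    unfolding AB(1)
  proof (intro nn_integral_cong arg_cong2[where f = "(*)"])
    fix p :: "'a \<Rightarrow> real"
    have "(\<Prod>v\<in>A \<union> B. ?I (simplex_point V w p v)) = (\<Prod>v\<in>A \<union> B. ?I (p v))"
      using AB(4) by (intro prod.cong) (auto simp: simplex_point_def)
    moreover have "simplex_point V w p w = 1 - (\<Sum>v\<in>A. p v) - (\<Sum>v\<in>B. p v)"
      using fin AB by (simp add: simplex_point_def AB(1) sum.union_disjoint)
    moreover have "(\<Prod>v\<in>V. ?I (simplex_point V w p v)) =
        ?I (simplex_point V w p w) * (\<Prod>v\<in>A \<union> B. ?I (simplex_point V w p v))"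
      using fin AB(4) by (subst (1) AB(3)) simp
    ultimately show "ennreal (dirichlet_density V (\<lambda>_. 1) (simplex_point V w p)) =
        ?c * (?I (1 - (\<Sum>v\<in>A. p v) - (\<Sum>v\<in>B. p v)) * ((\<Prod>v\<in>A. ?I (p v)) * (\<Prod>v\<in>B. ?I (p v))))"
      using fin AB(2) by (simp add: ennreal_dirichlet_density_uniform[OF assms(1)] prod.union_disjoint)
    show "h (\<Sum>v\<in>A. simplex_point V w p v) = h (\<Sum>v\<in>A. p v)"
      using wV(2) by (intro arg_cong[where f = h] sum.cong) (auto simp: simplex_point_def)
  qed
  also have "\<dots> = (\<integral>\<^sup>+x. \<integral>\<^sup>+y. ?c * (?I (1 - (\<Sum>v\<in>A. merge A B (x, y) v) - (\<Sum>v\<in>B. merge A B (x, y) v)) *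
        ((\<Prod>v\<in>A. ?I (merge A B (x, y) v)) * (\<Prod>v\<in>B. ?I (merge A B (x, y) v)))) *
        h (\<Sum>v\<in>A. merge A B (x, y) v) \<partial>?L B \<partial>?L A)"
    using AB(2) fin by (intro lborel_PiM.product_nn_integral_fold) measurable
  also have "\<dots> = (\<integral>\<^sup>+x. \<integral>\<^sup>+y. (?c * h (\<Sum>v\<in>A. x v) * (\<Prod>v\<in>A. ?I (x v))) *
        (?I ((1 - (\<Sum>v\<in>A. x v)) - (\<Sum>v\<in>B. y v)) * (\<Prod>v\<in>B. ?I (y v))) \<partial>?L B \<partial>?L A)"
  proof (intro nn_integral_cong)
    fix x y :: "'a \<Rightarrow> real"
    have "(\<Sum>v\<in>A. merge A B (x, y) v) = (\<Sum>v\<in>A. x v)" "(\<Sum>v\<in>B. merge A B (x, y) v) = (\<Sum>v\<in>B. y v)"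
      "(\<Prod>v\<in>A. ?I (merge A B (x, y) v)) = (\<Prod>v\<in>A. ?I (x v))"
      "(\<Prod>v\<in>B. ?I (merge A B (x, y) v)) = (\<Prod>v\<in>B. ?I (y v))"
      using AB(2) by (auto intro!: sum.cong prod.cong simp: merge_def)
    thus "?c * (?I (1 - (\<Sum>v\<in>A. merge A B (x, y) v) - (\<Sum>v\<in>B. merge A B (x, y) v)) *
        ((\<Prod>v\<in>A. ?I (merge A B (x, y) v)) * (\<Prod>v\<in>B. ?I (merge A B (x, y) v)))) *
        h (\<Sum>v\<in>A. merge A B (x, y) v) =
        (?c * h (\<Sum>v\<in>A. x v) * (\<Prod>v\<in>A. ?I (x v))) *
        (?I ((1 - (\<Sum>v\<in>A. x v)) - (\<Sum>v\<in>B. y v)) * (\<Prod>v\<in>B. ?I (y v)))"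
      by (simp add: mult_ac)
  qed
  also have "\<dots> = (\<integral>\<^sup>+x. (?c * h (\<Sum>v\<in>A. x v) * (\<Prod>v\<in>A. ?I (x v))) *
        (\<integral>\<^sup>+y. ?I ((1 - (\<Sum>v\<in>A. x v)) - (\<Sum>v\<in>B. y v)) * (\<Prod>v\<in>B. ?I (y v)) \<partial>?L B) \<partial>?L A)"
    by (intro nn_integral_cong nn_integral_cmult) measurable
  \<comment> \<open>For fixed coordinates in \<open>A\<close> the others range over a corner simplex
    of size \<open>1 - (\<Sum>v\<in>A. x v)\<close>. The result depends on \<open>x\<close> only
    through positivity and this sum, so the orthant formula applies next.\<close>
  also have "\<dots> = (\<integral>\<^sup>+x. (?c * h (\<Sum>v\<in>A. x v) *
        (ennreal ((1 - (\<Sum>v\<in>A. x v)) ^ b / fact b) * ?I (1 - (\<Sum>v\<in>A. x v)))) * (\<Prod>v\<in>A. ?I (x v)) \<partial>?L A)"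
    unfolding nn_integral_corner_simplex[OF fin(2)] b_def by (simp add: mult_ac)
  also have "\<dots> = (\<integral>\<^sup>+s. (?c * h s * (ennreal ((1 - s) ^ b / fact b) * ?I (1 - s))) *
        (ennreal (s ^ (card A - 1) / fact (card A - 1)) * ?I s) \<partial>lborel)"
    using fin(1) assms(3) by (rule nn_integral_pos_orthant_sum) measurable
  also have "\<dots> = (\<integral>\<^sup>+s. h s * ennreal (beta_density (card A) (card (V - A)) s) \<partial>lborel)"
  proof (intro nn_integral_cong)
    fix s :: real
    show "(?c * h s * (ennreal ((1 - s) ^ b / fact b) * ?I (1 - s))) *
        (ennreal (s ^ (card A - 1) / fact (card A - 1)) * ?I s) =
        h s * ennreal (beta_density (card A) (card (V - A)) s)"
    proof (cases "0 < s")
      case True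
      have "?c * h s * (ennreal ((1 - s) ^ b / fact b) * ?I (1 - s)) *
          (ennreal (s ^ (card A - 1) / fact (card A - 1)) * ?I s) =
          h s * (?c * (ennreal ((1 - s) ^ b / fact b) * ?I (1 - s)) *
          ennreal (s ^ (card A - 1) / fact (card A - 1)))"
        using True by (simp add: mult_ac)
      thus ?thesis
        using beta_density_nat[OF cards(3) True, of b] by (simp add: cards(1,2))
    qed (simp add: beta_density_def)
  qed
  finally show ?thesis .
qed

lemma distr_dirichlet_uniform_subset_sum_off_pivot:
  assumes "finite V" "A \<subseteq> V" "A \<noteq> {}" and "(SOME w. w \<in> V) \<in> V - A"
  shows "distr (dirichlet V (\<lambda>_. 1)) borel (\<lambda>\<sigma>. \<Sum>v\<in>A. \<sigma> v) =
         density lborel (beta_density (card A) (card (V - A)))"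
proof (rule measure_eqI)
  fix X :: "real set" assume "X \<in> sets (distr (dirichlet V (\<lambda>_. 1)) borel (\<lambda>\<sigma>. \<Sum>v\<in>A. \<sigma> v))"
  hence [measurable]: "X \<in> sets borel"
    by simp
  have [measurable]: "(\<lambda>\<sigma>. \<Sum>v\<in>A. \<sigma> v) \<in> borel_measurable (dirichlet V (\<lambda>_. 1))"
    unfolding measurable_cong_sets[OF sets_dirichlet refl]
    using assms(2) by (intro borel_measurable_sum measurable_component_singleton) auto
  have "emeasure (distr (dirichlet V (\<lambda>_. 1)) borel (\<lambda>\<sigma>. \<Sum>v\<in>A. \<sigma> v)) X =
      (\<integral>\<^sup>+\<sigma>. indicator X (\<Sum>v\<in>A. \<sigma> v) \<partial>dirichlet V (\<lambda>_. 1))"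
    by (subst nn_integral_indicator[symmetric], simp, subst nn_integral_distr) simp_all
  thus "emeasure (distr (dirichlet V (\<lambda>_. 1)) borel (\<lambda>\<sigma>. \<Sum>v\<in>A. \<sigma> v)) X =
      emeasure (density lborel (beta_density (card A) (card (V - A)))) X"
    using nn_integral_dirichlet_uniform_subset_sum_off_pivot[OF assms, of "indicator X"]
    by (simp add: emeasure_density mult.commute)
qed simp

lemma measurable_dirichlet_sum [measurable]:
  assumes "A \<subseteq> V"
  shows "(\<lambda>\<sigma>. \<Sum>v\<in>A. \<sigma> v) \<in> borel_measurable (dirichlet V \<alpha>)"
  unfolding measurable_cong_sets[OF sets_dirichlet refl]
  using assms by (intro borel_measurable_sum measurable_component_singleton) auto

text \<open>\<open>simplex_point\<close> fills the pivot with one minus the sum of the rest, so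
  every point of its image has total mass 1.\<close>

lemma AE_dirichlet_sum_eq_1:
  assumes "finite V" "V \<noteq> {}"
  shows "AE \<sigma> in dirichlet V \<alpha>. (\<Sum>v\<in>V. \<sigma> v) = 1"
proof -
  define w where "w = (SOME w. w \<in> V)"
  have w: "w \<in> V"
    using assms(2) by (simp add: w_def some_in_eq)
  have sum: "(\<Sum>v\<in>V. simplex_point V w p v) = 1" for p
  proof -
    have "(\<Sum>v\<in>V. simplex_point V w p v) = simplex_point V w p w + (\<Sum>v\<in>V - {w}. simplex_point V w p v)"
      using assms(1) w by (rule sum.remove)
    also have "(\<Sum>v\<in>V - {w}. simplex_point V w p v) = (\<Sum>v\<in>V - {w}. p v)"
      by (intro sum.cong) (auto simp: simplex_point_def)
    finally show ?thesis
      by (simp add: simplex_point_def)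
  qed
  have [measurable]: "simplex_point V w \<in> (\<Pi>\<^sub>M v\<in>V - {w}. lborel) \<rightarrow>\<^sub>M (\<Pi>\<^sub>M v\<in>V. borel)"
    using w by (rule measurable_simplex_point)
  have [measurable]: "(\<lambda>\<sigma>. \<Sum>v\<in>V. \<sigma> v) \<in> borel_measurable (\<Pi>\<^sub>M v\<in>V. (borel :: real measure))"
    by (intro borel_measurable_sum measurable_component_singleton)
  show ?thesis
    unfolding dirichlet_def Let_def w_def[symmetric]
    by (subst AE_distr_iff) (auto simp: sum)
qed

lemma beta_density_reflect: "beta_density a b (1 - s) = beta_density b a s"
  by (auto simp: beta_density_def indicator_def Beta_commute mult.commute)

text \<open>If the pivot lies in \<open>A\<close>, the sum over \<open>A\<close> is almost
  everywhere one minus the sum over \<open>V - A\<close>, which avoids the pivot; the reflection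
  \<open>s \<mapsto> 1 - s\<close> swaps the Beta parameters back. Strict inclusion keeps the
  complement nonempty.\<close>

lemma distr_dirichlet_uniform_subset_sum:
  assumes "finite V" "A \<subset> V" "A \<noteq> {}"
  shows "distr (dirichlet V (\<lambda>_. 1)) borel (\<lambda>\<sigma>. \<Sum>v\<in>A. \<sigma> v) =
         density lborel (beta_density (card A) (card (V - A)))"
proof (cases "(SOME w. w \<in> V) \<in> A")
  case False
  have "(SOME w. w \<in> V) \<in> V"
    using assms by (intro some_in_eq[THEN iffD2]) auto
  thus ?thesis
    using assms False by (intro distr_dirichlet_uniform_subset_sum_off_pivot) auto
next
  case True
  let ?D = "dirichlet V (\<lambda>_. 1)"
  let ?\<beta> = "beta_density (card (V - A)) (card A)"
  have VA: "V - (V - A) = A"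
    using assms by auto
  have [measurable]: "(\<lambda>\<sigma>. \<Sum>v\<in>A. \<sigma> v) \<in> borel_measurable ?D"
    "(\<lambda>\<sigma>. \<Sum>v\<in>V - A. \<sigma> v) \<in> borel_measurable ?D"
    using assms by (auto intro!: measurable_dirichlet_sum)
  have "distr ?D borel (\<lambda>\<sigma>. \<Sum>v\<in>A. \<sigma> v) = distr ?D borel (\<lambda>\<sigma>. 1 - (\<Sum>v\<in>V - A. \<sigma> v))"
  proof (rule distr_cong_AE)
    have "AE \<sigma> in ?D. (\<Sum>v\<in>V. \<sigma> v) = 1"
      using assms by (intro AE_dirichlet_sum_eq_1) auto
    thus "AE \<sigma> in ?D. (\<Sum>v\<in>A. \<sigma> v) = 1 - (\<Sum>v\<in>V - A. \<sigma> v)"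
      by eventually_elim (use assms in \<open>simp add: sum_diff psubset_imp_subset\<close>)
  qed auto
  also have "\<dots> = distr (distr ?D borel (\<lambda>\<sigma>. \<Sum>v\<in>V - A. \<sigma> v)) borel (\<lambda>s. 1 - s)"
    by (subst distr_distr) (auto simp: o_def)
  also have "distr ?D borel (\<lambda>\<sigma>. \<Sum>v\<in>V - A. \<sigma> v) = density lborel ?\<beta>"
    using assms True distr_dirichlet_uniform_subset_sum_off_pivot[of V "V - A"] by (auto simp: VA)
  also have "distr (density lborel ?\<beta>) borel (\<lambda>s. 1 - s) =
      density lborel (beta_density (card A) (card (V - A)))"
  proof (rule measure_eqI)
    fix X :: "real set" assume "X \<in> sets (distr (density lborel ?\<beta>) borel (\<lambda>s. 1 - s))"
    hence [measurable]: "X \<in> sets borel"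
      by simp
    have "emeasure (distr (density lborel ?\<beta>) borel (\<lambda>s. 1 - s)) X =
        (\<integral>\<^sup>+s. ennreal (?\<beta> s) * indicator X (1 - s) \<partial>lborel)"
      by (subst nn_integral_indicator[symmetric], simp, subst nn_integral_distr)
        (simp_all add: nn_integral_density)
    also have "\<dots> = (\<integral>\<^sup>+s. ennreal (?\<beta> (1 - s)) * indicator X s \<partial>lborel)"
      by (subst nn_integral_real_affine[where c = "- 1" and t = 1]) simp_all
    finally show "emeasure (distr (density lborel ?\<beta>) borel (\<lambda>s. 1 - s)) X =
        emeasure (density lborel (beta_density (card A) (card (V - A)))) X"
      by (simp add: beta_density_reflect emeasure_density)
  qed simp
  finally show ?thesis .
qed

section \<open>Beta integrals and Euler's integral\<close>

lemma Beta_real_pos: "0 < a \<Longrightarrow> 0 < b \<Longrightarrow> 0 < Beta a (b :: real)"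
  by (simp add: Beta_def Gamma_real_pos)

lemma beta_density_nonneg: "0 < a \<Longrightarrow> 0 < b \<Longrightarrow> 0 \<le> beta_density a b s"
  using Beta_real_pos[of a b] by (auto simp: beta_density_def indicator_def)

text \<open>The factor \<open>a / (a + b)\<close> is the ratio of \<open>Beta (a + 1) b\<close> to
  \<open>Beta a b\<close>. This rule yields the Beta moments and the parameter shift in the
  hypergeometric formula.\<close>

lemma mult_beta_density:
  assumes "0 < a" "0 < b"
  shows "s * beta_density a b s = a / (a + b) * beta_density (a + 1) b s"
proof (cases "s \<in> {0<..<1}")
  case True
  have "s * s powr (a - 1) = s powr (a + 1 - 1)"
    using True powr_add[of s 1 "a - 1"] by simp
  moreover have "(a + b) * Beta (a + 1) b = a * Beta a b"
    using assms by (intro Beta_plus1_left) auto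
  moreover have "Beta a b \<noteq> 0" "Beta (a + 1) b \<noteq> 0"
    using assms Beta_real_pos[of a b] Beta_real_pos[of "a + 1" b] by auto
  ultimately show ?thesis
    using True assms by (simp add: beta_density_def field_simps)
qed (simp add: beta_density_def)

lemma has_bochner_integral_beta_density:
  assumes "0 < a" "0 < b"
  shows "has_bochner_integral lborel (beta_density a b) 1"
proof -
  let ?f = "\<lambda>t. t powr (a - 1) * (1 - t) powr (b - 1)"
  have nz: "Beta a b \<noteq> 0"
    using Beta_real_pos[OF assms] by simp
  have "has_bochner_integral lborel (\<lambda>t. indicator {0..1} t *\<^sub>R ?f t) (Beta a b)"
    using integrable_Beta[OF assms] set_borel_integral_eq_integral(2)[OF integrable_Beta[OF assms]]
      integral_unique[OF has_integral_Beta_real[OF assms]]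
    by (simp add: has_bochner_integral_iff set_integrable_def set_lebesgue_integral_def)
  hence "has_bochner_integral lborel (\<lambda>t. indicator {0..1} t *\<^sub>R ?f t / Beta a b) (Beta a b / Beta a b)"
    by (rule has_bochner_integral_divide_zero)
  \<comment> \<open>This holds at the endpoints too, since \<open>0 powr x = 0\<close> for every
    exponent, including 0.\<close>
  moreover have "indicator {0..1} t *\<^sub>R ?f t / Beta a b = beta_density a b t" for t
    by (auto simp: beta_density_def indicator_def)
  ultimately show ?thesis
    using nz by simp
qed

text \<open>By compactness \<open>f\<close> is bounded on \<open>{0..1}\<close>, and the density
  vanishes elsewhere, so a multiple of the density dominates the product.\<close>

lemma integrable_beta_density_mult:
  assumes "0 < a" "0 < b" and [measurable]: "f \<in> borel_measurable borel" and "continuous_on {0..1} f"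
  shows "integrable lborel (\<lambda>s. beta_density a b s * f s)"
proof -
  have "bounded (f ` {0..1})"
    using assms(4) by (intro compact_imp_bounded compact_continuous_image) auto
  then obtain C where C: "\<forall>y\<in>f ` {0..1}. norm y \<le> C"
    unfolding bounded_iff by blast
  have "integrable lborel (\<lambda>s. C * beta_density a b s)"
    using has_bochner_integral_beta_density[OF assms(1,2)] by (auto simp: has_bochner_integral_iff)
  thus ?thesis
  proof (rule Bochner_Integration.integrable_bound, measurable, intro AE_I2)
    fix s
    show "norm (beta_density a b s * f s) \<le> norm (C * beta_density a b s)"
    proof (cases "s \<in> {0<..<1}")
      case True
      hence "f s \<in> f ` {0..1}"
        by (intro imageI) simp
      with C have "norm (f s) \<le> C"
        by blast
      hence "\<bar>f s\<bar> \<le> \<bar>C\<bar>"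
        by simp
      thus ?thesis
        by (simp add: abs_mult mult_right_mono mult.commute)
    qed (simp add: beta_density_def)
  qed
qed

text \<open>Absorbing \<open>1 / Beta b (c - b)\<close> makes Euler's integral an expectation under
  a Beta law. The condition \<open>z < 1\<close> keeps \<open>1 - z * t\<close> positive on
  \<open>{0..1}\<close>; the resulting integrability lets the gauge integral in
  \<open>hyp2F1\<close> agree with the Lebesgue integral.\<close>

lemma hyp2F1_eq_beta_integral:
  assumes "0 < b" "b < c" "z < 1"
  shows "hyp2F1 a b c z = (\<integral>t. beta_density b (c - b) t * (1 - z * t) powr (- a) \<partial>lborel)"
proof -
  let ?f = "\<lambda>t. t powr (b - 1) * (1 - t) powr (c - b - 1) * (1 - z * t) powr (- a)"
  have pos: "0 < 1 - z * t" if "t \<in> {0..1}" for t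
  proof (cases "0 \<le> z")
    case True
    hence "z * t \<le> z * 1"
      using that by (intro mult_left_mono) auto
    thus ?thesis using assms by simp
  next
    case False
    hence "z * t \<le> 0"
      using that by (intro mult_nonpos_nonneg) auto
    thus ?thesis by simp
  qed
  have nz: "Beta b (c - b) \<noteq> 0"
    using assms Beta_real_pos[of b "c - b"] by simp
  have eq: "indicator {0..1} t *\<^sub>R ?f t =
      Beta b (c - b) * (beta_density b (c - b) t * (1 - z * t) powr (- a))" for t
    using nz by (auto simp: beta_density_def indicator_def)
  have "integrable lborel (\<lambda>t. beta_density b (c - b) t * (1 - z * t) powr (- a))"
    using assms pos by (intro integrable_beta_density_mult) (auto intro!: continuous_intros dest!: pos)
  hence "set_integrable lborel {0..1} ?f"
    unfolding set_integrable_def eq by simp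
  from set_borel_integral_eq_integral(2)[OF this]
  have "integral {0..1} ?f =
      Beta b (c - b) * (\<integral>t. beta_density b (c - b) t * (1 - z * t) powr (- a) \<partial>lborel)"
    unfolding set_lebesgue_integral_def eq by simp
  thus ?thesis
    using nz by (simp add: hyp2F1_def)
qed

section \<open>The conditional probability of a green token\<close>

text \<open>For \<open>s\<close> strictly between 0 and 1 this map adds \<delta> to the log-odds of
  \<open>s\<close>. Its value at \<gamma> is the limit in the theorem.\<close>

definition tilt :: "real \<Rightarrow> real \<Rightarrow> real" where
  "tilt \<delta> s = exp \<delta> * s / (1 + (exp \<delta> - 1) * s)"

lemma measurable_tilt [measurable]: "tilt \<delta> \<in> borel_measurable borel"
  unfolding tilt_def by measurable

text \<open>The denominator is the convex combination \<open>exp \<delta> * s + (1 - s)\<close> of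
  two positive numbers.\<close>

lemma tilt_denominator_pos:
  assumes "s \<in> {0..1}"
  shows "0 < 1 + (exp \<delta> - 1) * (s :: real)"
proof (cases "s = 0")
  case False
  hence "0 < exp \<delta> * s + (1 - s)"
    using assms by (intro add_pos_nonneg) auto
  thus ?thesis
    by (simp add: algebra_simps)
qed simp

lemma continuous_on_tilt: "continuous_on {0..1} (tilt \<delta>)"
  unfolding tilt_def
proof (intro continuous_intros ballI)
  fix s :: real assume "s \<in> {0..1}"
  from tilt_denominator_pos[OF this, of \<delta>] show "1 + (exp \<delta> - 1) * s \<noteq> 0"
    by simp
qed

text \<open>Since the total mass is 1, the normaliser splits into the unweighted mass outside
  \<open>G\<close> and \<open>exp \<delta>\<close> times the mass of \<open>G\<close>.\<close>

lemma sum_watermark_prob: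
  assumes "finite V" "G \<subseteq> V" "(\<Sum>v\<in>V. \<sigma> v) = 1"
  shows "(\<Sum>v\<in>G. watermark_prob V \<delta> \<sigma> G v) = tilt \<delta> (\<Sum>v\<in>G. \<sigma> v)"
proof -
  have "(\<Sum>v\<in>V - G. \<sigma> v) = 1 - (\<Sum>v\<in>G. \<sigma> v)"
    using assms by (simp add: sum_diff)
  moreover have "(\<Sum>u\<in>V. exp (\<delta> * indicator G u) * \<sigma> u) =
      (\<Sum>u\<in>V - G. exp (\<delta> * indicator G u) * \<sigma> u) + (\<Sum>u\<in>G. exp (\<delta> * indicator G u) * \<sigma> u)"
    using assms(2,1) by (rule sum.subset_diff)
  ultimately have "(\<Sum>u\<in>V. exp (\<delta> * indicator G u) * \<sigma> u) = 1 + (exp \<delta> - 1) * (\<Sum>v\<in>G. \<sigma> v)"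
    by (simp add: algebra_simps flip: sum_distrib_left)
  thus ?thesis
    by (simp add: watermark_prob_def tilt_def flip: sum_divide_distrib sum_distrib_left)
qed

text \<open>The law of the green mass depends only on the size of the green list, so all terms of
  the average over green lists coincide.\<close>

lemma green_prob_eq_beta_integral:
  assumes "finite V" "0 < k" "k < card V" and k: "real k = \<gamma> * real (card V)"
  shows "green_prob V \<gamma> \<delta> = (\<integral>s. beta_density k (card V - k) s * tilt \<delta> s \<partial>lborel)"
proof -
  let ?D = "dirichlet V (\<lambda>_. 1)" and ?A = "green_lists V \<gamma>"
  let ?I = "\<integral>s. beta_density k (card V - k) s * tilt \<delta> s \<partial>lborel"
  have V: "V \<noteq> {}"
    using assms by auto
  have finA: "finite ?A"
    using assms(1) by (rule finite_green_lists)
  \<comment> \<open>At least one admissible green list exists, so the average does not divide by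
    zero.\<close>
  obtain G0 where "G0 \<subseteq> V" "card G0 = k"
    using obtain_subset_with_card_n[of k V] assms by auto
  hence "G0 \<in> ?A"
    using k by (simp add: green_lists_def)
  hence cardA: "card ?A \<noteq> 0"
    using finA by auto
  have sub: "G \<subseteq> V" if "G \<in> ?A" for G
    using that by (simp add: green_lists_def)
  have law: "distr ?D borel (\<lambda>\<sigma>. \<Sum>v\<in>G. \<sigma> v) = density lborel (beta_density k (card V - k))"
    if G: "G \<in> ?A" for G
  proof -
    have "real (card G) = real k"
      using G k by (simp add: green_lists_def)
    hence "card G = k"
      by simp
    moreover from this have "G \<subset> V" "G \<noteq> {}"
      using sub[OF G] assms(2,3) by auto
    moreover from this have "card (V - G) = card V - k"
      using sub[OF G] assms(1) \<open>card G = k\<close> by (simp add: card_Diff_subset finite_subset)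
    ultimately show ?thesis
      using distr_dirichlet_uniform_subset_sum[OF assms(1), of G] by simp
  qed
  have meas [measurable]: "(\<lambda>\<sigma>. \<Sum>v\<in>G. \<sigma> v) \<in> borel_measurable ?D" if "G \<in> ?A" for G
    using sub[OF that] by (rule measurable_dirichlet_sum)
  have pos: "0 < real k" "0 < real (card V - k)"
    using assms(2,3) by auto
  have int: "integrable ?D (\<lambda>\<sigma>. tilt \<delta> (\<Sum>v\<in>G. \<sigma> v))" if G: "G \<in> ?A" for G
  proof -
    have "integrable (distr ?D borel (\<lambda>\<sigma>. \<Sum>v\<in>G. \<sigma> v)) (tilt \<delta>)"
      unfolding law[OF G] using pos
      by (subst integrable_density)
        (auto intro!: integrable_beta_density_mult continuous_on_tilt beta_density_nonneg)
    thus ?thesis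
      using G by (subst (asm) integrable_distr_eq) auto
  qed
  have val: "(\<integral>\<sigma>. tilt \<delta> (\<Sum>v\<in>G. \<sigma> v) \<partial>?D) = ?I" if G: "G \<in> ?A" for G
  proof -
    have "(\<integral>\<sigma>. tilt \<delta> (\<Sum>v\<in>G. \<sigma> v) \<partial>?D) = (\<integral>s. tilt \<delta> s \<partial>distr ?D borel (\<lambda>\<sigma>. \<Sum>v\<in>G. \<sigma> v))"
      using G by (subst integral_distr) auto
    also have "\<dots> = ?I"
      unfolding law[OF G] using pos by (subst integral_density) (auto intro!: beta_density_nonneg)
    finally show ?thesis .
  qed
  have "green_prob V \<gamma> \<delta> =
      (\<integral>\<sigma>. (\<Sum>G\<in>?A. \<Sum>v\<in>G. watermark_prob V \<delta> \<sigma> G v) / card ?A \<partial>?D)"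
    by (simp add: green_prob_eq_expectation[OF assms(1) V] integral_uniform_count_measure finA)
  also have "\<dots> = (\<integral>\<sigma>. (\<Sum>G\<in>?A. tilt \<delta> (\<Sum>v\<in>G. \<sigma> v)) / card ?A \<partial>?D)"
  proof (rule integral_cong_AE)
    have comp: "(\<lambda>\<sigma>. \<sigma> v) \<in> borel_measurable ?D" if "v \<in> V" for v
      using measurable_dirichlet_sum[of "{v}" V] that by simp
    have "(\<lambda>\<sigma>. watermark_prob V \<delta> \<sigma> G v) \<in> borel_measurable ?D" if "v \<in> V" for G v
      unfolding watermark_prob_def
      by (intro borel_measurable_divide borel_measurable_times borel_measurable_sum
          borel_measurable_const comp that)
    thus "(\<lambda>\<sigma>. (\<Sum>G\<in>?A. \<Sum>v\<in>G. watermark_prob V \<delta> \<sigma> G v) / card ?A) \<in> borel_measurable ?D"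
      using sub by (intro borel_measurable_divide borel_measurable_sum borel_measurable_const) auto
    \<comment> \<open>The pointwise identity relies on total mass 1, which is available almost
      everywhere.\<close>
    show "AE \<sigma> in ?D. (\<Sum>G\<in>?A. \<Sum>v\<in>G. watermark_prob V \<delta> \<sigma> G v) / card ?A =
        (\<Sum>G\<in>?A. tilt \<delta> (\<Sum>v\<in>G. \<sigma> v)) / card ?A"
      using AE_dirichlet_sum_eq_1[OF assms(1) V, of "\<lambda>_. 1"]
      by eventually_elim
        (auto intro!: arg_cong2[where f = "(/)"] sum.cong sum_watermark_prob[OF assms(1)] dest: sub)
  qed measurable
  also have "\<dots> = (\<Sum>G\<in>?A. \<integral>\<sigma>. tilt \<delta> (\<Sum>v\<in>G. \<sigma> v) \<partial>?D) / card ?A"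
    using int by (simp add: Bochner_Integration.integral_sum)
  also have "\<dots> = ?I"
    using cardA by (simp add: val)
  finally show ?thesis .
qed

text \<open>The factor \<open>s\<close> in the numerator of \<open>tilt\<close> raises the first
  Beta parameter and produces the mean \<open>a / (a + b)\<close>; the reciprocal denominator is the
  Euler kernel with exponent -1 at \<open>z = - (exp \<delta> - 1)\<close>.\<close>

lemma beta_integral_tilt:
  assumes "0 < a" "0 < b" "0 \<le> \<delta>"
  shows "(\<integral>s. beta_density a b s * tilt \<delta> s \<partial>lborel) =
         exp \<delta> * (a / (a + b)) * hyp2F1 1 (a + 1) (a + b + 1) (- (exp \<delta> - 1))"
proof -
  have "beta_density a b s * tilt \<delta> s =
      exp \<delta> * (a / (a + b)) * (beta_density (a + 1) b s * (1 - - (exp \<delta> - 1) * s) powr - 1)" for s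
  proof (cases "s \<in> {0<..<1}")
    case True
    have "beta_density a b s * tilt \<delta> s =
        exp \<delta> * (s * beta_density a b s) * (1 / (1 + (exp \<delta> - 1) * s))"
      by (simp add: tilt_def)
    also have "1 / (1 + (exp \<delta> - 1) * s) = (1 - - (exp \<delta> - 1) * s) powr - 1"
    proof -
      have "0 < 1 + (exp \<delta> - 1) * s" "1 - - (exp \<delta> - 1) * s = 1 + (exp \<delta> - 1) * s"
        using True tilt_denominator_pos[of s \<delta>] by (simp_all only: mult_minus_left, auto)
      thus ?thesis
        by (simp only: powr_minus_divide powr_one)
    qed
    finally show ?thesis
      by (simp only: mult_beta_density[OF assms(1,2)] mult.assoc)
  qed (simp add: beta_density_def)
  moreover have "hyp2F1 1 (a + 1) (a + b + 1) (- (exp \<delta> - 1)) =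
      (\<integral>s. beta_density (a + 1) b s * (1 - - (exp \<delta> - 1) * s) powr - 1 \<partial>lborel)"
    using assms by (subst hyp2F1_eq_beta_integral) (auto simp: add_strict_increasing)
  ultimately show ?thesis
    by (simp only: Bochner_Integration.integral_mult_right_zero)
qed

section \<open>Concentration of the green mass and the error bound\<close>

text \<open>The difference is \<open>exp \<delta> * (s - t)\<close> over the product of the two
  denominators, and each denominator is at least 1 because \<open>\<delta> \<ge> 0\<close>.\<close>

lemma tilt_lipschitz:
  assumes "0 \<le> \<delta>" "s \<in> {0..1}" "t \<in> {0..1}"
  shows "\<bar>tilt \<delta> s - tilt \<delta> t\<bar> \<le> exp \<delta> * \<bar>s - t\<bar>"
proof -
  let ?d = "\<lambda>s. 1 + (exp \<delta> - 1) * s"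
  have ge: "1 \<le> ?d s" "1 \<le> ?d t"
    using assms by auto
  have "tilt \<delta> s - tilt \<delta> t = exp \<delta> * (s - t) / (?d s * ?d t)"
    using ge unfolding tilt_def by (subst diff_frac_eq) (auto simp: algebra_simps)
  hence "\<bar>tilt \<delta> s - tilt \<delta> t\<bar> = exp \<delta> * \<bar>s - t\<bar> / (?d s * ?d t)"
    using ge by (simp add: abs_mult abs_of_pos)
  also have "\<dots> \<le> exp \<delta> * \<bar>s - t\<bar> / 1"
  proof (intro divide_left_mono)
    show "1 \<le> ?d s * ?d t"
      using mult_mono[OF ge] ge by simp
    thus "0 < ?d s * ?d t * 1"
      by simp
  qed auto
  finally show ?thesis by simp
qed

text \<open>Expanding the square and absorbing each factor \<open>s\<close> into the density leaves
  a combination of three Beta densities, each of total mass 1.\<close>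

lemma has_bochner_integral_beta_variance:
  assumes "0 < a" "0 < b"
  shows "has_bochner_integral lborel (\<lambda>s. beta_density a b s * (s - a / (a + b))\<^sup>2)
           (a * b / ((a + b)\<^sup>2 * (a + b + 1)))"
proof -
  let ?m = "a / (a + b)" and ?m' = "(a + 1) / (a + b + 1)"
  have "beta_density a b s * (s - ?m)\<^sup>2 =
      ?m * ?m' * beta_density (a + 2) b s - 2 * ?m * (?m * beta_density (a + 1) b s) + ?m\<^sup>2 * beta_density a b s" for s
  proof -
    have "beta_density a b s * (s - ?m)\<^sup>2 = s * (s * beta_density a b s)
        - 2 * ?m * (s * beta_density a b s) + ?m\<^sup>2 * beta_density a b s"
      by (simp add: power2_eq_square algebra_simps)
    also have "s * (s * beta_density a b s) = ?m * (s * beta_density (a + 1) b s)"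
      by (simp only: mult_beta_density[OF assms] mult.left_commute)
    also have "s * beta_density (a + 1) b s = ?m' * beta_density (a + 2) b s"
      using assms mult_beta_density[of "a + 1" b s] by (simp add: add_ac)
    finally show ?thesis
      by (simp only: mult_beta_density[OF assms] mult.assoc)
  qed
  moreover have "has_bochner_integral lborel (\<lambda>s. ?m * ?m' * beta_density (a + 2) b s
      - 2 * ?m * (?m * beta_density (a + 1) b s) + ?m\<^sup>2 * beta_density a b s)
      (?m * ?m' * 1 - 2 * ?m * (?m * 1) + ?m\<^sup>2 * 1)"
    using assms
    by (intro has_bochner_integral_add has_bochner_integral_diff has_bochner_integral_mult_right
        has_bochner_integral_beta_density) auto
  moreover have "?m * ?m' * 1 - 2 * ?m * (?m * 1) + ?m\<^sup>2 * 1 = a * b / ((a + b)\<^sup>2 * (a + b + 1))"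
  proof -
    have "a + b \<noteq> 0" "a + b + 1 \<noteq> 0"
      using assms by auto
    thus ?thesis
      by (simp add: divide_simps power2_eq_square) (simp add: algebra_simps)
  qed
  ultimately show ?thesis
    by simp
qed

text \<open>The Lipschitz bound reduces the error to the mean absolute deviation. An integrable
  pointwise majorant \<open>?B\<close> controls it through the variance: its two terms each
  contribute at most half of the final bound.\<close>

lemma beta_integral_tilt_approx:
  assumes "0 < a" "0 < b" "0 \<le> \<delta>"
  shows "\<bar>(\<integral>s. beta_density a b s * tilt \<delta> s \<partial>lborel) - tilt \<delta> (a / (a + b))\<bar> \<le> exp \<delta> / sqrt (a + b)"
proof -
  let ?m = "a / (a + b)" and ?r = "sqrt (a + b)" and ?\<beta> = "beta_density a b"
  have r: "0 < ?r" "?r\<^sup>2 = a + b"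
    using assms by auto
  have m: "?m \<in> {0..1}"
    using assms by (auto simp: divide_simps)
  have one: "has_bochner_integral lborel ?\<beta> 1"
    using assms(1,2) by (rule has_bochner_integral_beta_density)
  have tilt: "integrable lborel (\<lambda>s. ?\<beta> s * tilt \<delta> s)"
    using assms by (intro integrable_beta_density_mult continuous_on_tilt) auto
  let ?V = "a * b / ((a + b)\<^sup>2 * (a + b + 1))"
  let ?B = "\<lambda>s. exp \<delta> / 2 * (1 / ?r * ?\<beta> s + ?r * (?\<beta> s * (s - ?m)\<^sup>2))"
  have B: "has_bochner_integral lborel ?B (exp \<delta> / 2 * (1 / ?r * 1 + ?r * ?V))"
    by (intro has_bochner_integral_mult_right has_bochner_integral_add one
        has_bochner_integral_beta_variance assms)
  have pointwise: "\<bar>?\<beta> s * tilt \<delta> s - tilt \<delta> ?m * ?\<beta> s\<bar> \<le> ?B s" for s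
  proof (cases "s \<in> {0<..<1}")
    case True
    \<comment> \<open>AM-GM, with weights making both terms of order \<open>(a + b) powr (- 1 / 2)\<close> in the mean\<close>
    have "\<bar>s - ?m\<bar> \<le> (1 / ?r + ?r * (s - ?m)\<^sup>2) / 2"
    proof -
      have "0 \<le> (1 - ?r * \<bar>s - ?m\<bar>)\<^sup>2"
        by simp
      also have "\<dots> = ?r * ((1 / ?r + ?r * (s - ?m)\<^sup>2) - 2 * \<bar>s - ?m\<bar>)"
        using r(1) by (simp add: power2_eq_square algebra_simps flip: abs_mult)
      finally show ?thesis
        using r(1) by (simp add: zero_le_mult_iff)
    qed
    hence "exp \<delta> * \<bar>s - ?m\<bar> \<le> exp \<delta> * ((1 / ?r + ?r * (s - ?m)\<^sup>2) / 2)"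
      by (intro mult_left_mono) auto
    moreover have "\<bar>tilt \<delta> s - tilt \<delta> ?m\<bar> \<le> exp \<delta> * \<bar>s - ?m\<bar>"
      using True by (intro tilt_lipschitz assms m) auto
    ultimately have "\<bar>tilt \<delta> s - tilt \<delta> ?m\<bar> \<le> exp \<delta> * ((1 / ?r + ?r * (s - ?m)\<^sup>2) / 2)"
      by linarith
    hence "?\<beta> s * \<bar>tilt \<delta> s - tilt \<delta> ?m\<bar> \<le> ?\<beta> s * (exp \<delta> * ((1 / ?r + ?r * (s - ?m)\<^sup>2) / 2))"
      using assms by (intro mult_left_mono beta_density_nonneg)
    also have "?\<beta> s * \<bar>tilt \<delta> s - tilt \<delta> ?m\<bar> = \<bar>?\<beta> s * (tilt \<delta> s - tilt \<delta> ?m)\<bar>"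
      using assms by (simp add: abs_mult beta_density_nonneg)
    finally show ?thesis
      by (simp add: algebra_simps add_divide_distrib)
  qed (simp add: beta_density_def)
  have int: "integrable lborel (\<lambda>s. ?\<beta> s * tilt \<delta> s - tilt \<delta> ?m * ?\<beta> s)"
    using one tilt by (intro Bochner_Integration.integrable_diff integrable_mult_right)
      (auto simp: has_bochner_integral_iff)
  have diff: "(\<integral>s. ?\<beta> s * tilt \<delta> s \<partial>lborel) - tilt \<delta> ?m =
      (\<integral>s. ?\<beta> s * tilt \<delta> s - tilt \<delta> ?m * ?\<beta> s \<partial>lborel)"
    using one tilt by (simp add: has_bochner_integral_iff)
  have "norm (\<integral>s. ?\<beta> s * tilt \<delta> s - tilt \<delta> ?m * ?\<beta> s \<partial>lborel) \<le> (\<integral>s. ?B s \<partial>lborel)"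
    using pointwise
    by (intro Bochner_Integration.integral_norm_bound_integral int
        B[unfolded has_bochner_integral_iff, THEN conjunct1]) (simp only: real_norm_def)
  hence bound: "\<bar>(\<integral>s. ?\<beta> s * tilt \<delta> s \<partial>lborel) - tilt \<delta> ?m\<bar> \<le> exp \<delta> / 2 * (1 / ?r * 1 + ?r * ?V)"
    unfolding diff has_bochner_integral_integral_eq[OF B] real_norm_def .
  \<comment> \<open>This says that the variance is at most \<open>1 / (a + b)\<close>, by the crude
    estimate \<open>a * b \<le> (a + b) * (a + b + 1)\<close>.\<close>
  have "?r * ?V \<le> 1 / ?r"
  proof -
    have "a * b \<le> (a + b) * (a + b + 1)"
      using assms by (intro mult_mono) auto
    hence "(a + b) * ?V \<le> 1"
      using assms by (simp add: power2_eq_square divide_simps)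
    moreover have "?r\<^sup>2 * ?V = ?r * ?V * ?r"
      by (simp only: power2_eq_square mult_ac)
    ultimately have "?r * ?V * ?r \<le> 1"
      by (simp only: r(2))
    thus ?thesis
      using r(1) by (simp only: le_divide_eq if_True)
  qed
  hence "exp \<delta> / 2 * (1 / ?r * 1 + ?r * ?V) \<le> exp \<delta> / 2 * (1 / ?r * 1 + 1 / ?r)"
    by (intro mult_left_mono add_left_mono) auto
  also have "\<dots> = exp \<delta> / ?r"
    by simp
  finally show ?thesis
    using bound by linarith
qed

section \<open>Closed form and large-vocabulary limit of the green probability\<close>

text \<open>Both claims evaluate the Beta integral with parameters \<open>\<gamma> * n\<close> and
  \<open>(1 - \<gamma>) * n\<close>, where \<open>n = card V\<close>: the first exactly, the second
  by concentration at the mean \<gamma>. The error bound holds with constant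
  \<open>exp \<delta>\<close> for every nonempty admissible \<open>V\<close>, hence uniformly over
  vocabularies of equal size.\<close>

theorem theorem3p5:
  fixes \<gamma> \<delta> :: real
  assumes "0 < \<gamma>" and "\<gamma> < 1" and "0 < \<delta>"
  shows "(\<forall>V :: 'a set. finite V \<and> V \<noteq> {} \<and> \<gamma> * real (card V) \<in> \<int> \<longrightarrow>
            green_prob V \<gamma> \<delta> =
              exp \<delta> * \<gamma> *
              hyp2F1 1 (\<gamma> * real (card V) + 1) (real (card V) + 1) (- (exp \<delta> - 1))) \<and>
         (\<lambda>V :: 'a set. green_prob V \<gamma> \<delta> - exp \<delta> * \<gamma> / (1 + \<gamma> * (exp \<delta> - 1)))
           \<in> O[inf (filtercomap card at_top) (principal {V. finite V \<and> \<gamma> * real (card V) \<in> \<int>})](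
                 \<lambda>V. real (card V) powr (- 1 / 2))"
proof (intro conjI allI impI)
  have eq: "green_prob V \<gamma> \<delta> =
        (\<integral>s. beta_density (\<gamma> * card V) ((1 - \<gamma>) * card V) s * tilt \<delta> s \<partial>lborel)"
    and pos: "0 < \<gamma> * card V" "0 < (1 - \<gamma>) * card V"
    if V: "finite V" "V \<noteq> {}" "\<gamma> * real (card V) \<in> \<int>" for V :: "'a set"
  proof -
    have n: "0 < real (card V)"
      using V by (simp add: card_gt_0_iff)
    thus p: "0 < \<gamma> * card V" "0 < (1 - \<gamma>) * card V"
      using assms by auto
    \<comment> \<open>A positive integral \<open>\<gamma> * n\<close> is a natural number
      \<open>k\<close>, and \<open>0 < \<gamma> < 1\<close> places it strictly between 0 and
      \<open>n\<close>, so both Beta parameters are positive.\<close>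
    from V(3) obtain z where "\<gamma> * real (card V) = of_int z"
      by (auto simp: Ints_def)
    with p(1) have k: "\<gamma> * real (card V) = real (nat z)"
      by simp
    define k where "k = nat z"
    note k = k[folded k_def]
    have "0 < k" "k < card V"
      using p k by (auto simp: algebra_simps)
    with green_prob_eq_beta_integral[OF V(1) this k[symmetric]] k
    show "green_prob V \<gamma> \<delta> =
        (\<integral>s. beta_density (\<gamma> * card V) ((1 - \<gamma>) * card V) s * tilt \<delta> s \<partial>lborel)"
      by (simp add: of_nat_diff left_diff_distrib)
  qed
  {
    fix V :: "'a set" assume "finite V \<and> V \<noteq> {} \<and> \<gamma> * real (card V) \<in> \<int>"
    hence V: "finite V" "V \<noteq> {}" "\<gamma> * real (card V) \<in> \<int>"
      by auto
    have "card V \<noteq> 0"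
      using V by simp
    thus "green_prob V \<gamma> \<delta> = exp \<delta> * \<gamma> *
        hyp2F1 1 (\<gamma> * real (card V) + 1) (real (card V) + 1) (- (exp \<delta> - 1))"
      using beta_integral_tilt[OF pos[OF V], of \<delta>] assms
      by (simp add: eq[OF V] left_diff_distrib)
  }
  show "(\<lambda>V :: 'a set. green_prob V \<gamma> \<delta> - exp \<delta> * \<gamma> / (1 + \<gamma> * (exp \<delta> - 1)))
      \<in> O[inf (filtercomap card at_top) (principal {V. finite V \<and> \<gamma> * real (card V) \<in> \<int>})](
            \<lambda>V. real (card V) powr (- 1 / 2))"
  proof (rule bigoI[where c = "exp \<delta>"], unfold eventually_inf_principal)
    \<comment> \<open>The empty set meets the integrality condition; growth of \<open>card\<close>
      removes it.\<close>
    have "eventually (\<lambda>V :: 'a set. 1 \<le> card V) (filtercomap card at_top)"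
      by (intro eventually_filtercomapI eventually_ge_at_top)
    thus "eventually (\<lambda>V :: 'a set. V \<in> {V. finite V \<and> \<gamma> * real (card V) \<in> \<int>} \<longrightarrow>
        norm (green_prob V \<gamma> \<delta> - exp \<delta> * \<gamma> / (1 + \<gamma> * (exp \<delta> - 1)))
          \<le> exp \<delta> * norm (real (card V) powr (- 1 / 2))) (filtercomap card at_top)"
    proof (eventually_elim, intro impI)
      fix V :: "'a set" assume "1 \<le> card V" "V \<in> {V. finite V \<and> \<gamma> * real (card V) \<in> \<int>}"
      hence V: "finite V" "V \<noteq> {}" "\<gamma> * real (card V) \<in> \<int>" and n: "card V \<noteq> 0"
        by auto
      \<comment> \<open>The parameters add up to \<open>card V\<close> and the mean is \<gamma>, so
        the bound is centred at \<open>tilt \<delta> \<gamma>\<close>.\<close>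
      have "\<bar>green_prob V \<gamma> \<delta> - tilt \<delta> \<gamma>\<bar> \<le> exp \<delta> / sqrt (card V)"
        using beta_integral_tilt_approx[OF pos[OF V], of \<delta>] assms n
        by (simp add: eq[OF V] left_diff_distrib)
      thus "norm (green_prob V \<gamma> \<delta> - exp \<delta> * \<gamma> / (1 + \<gamma> * (exp \<delta> - 1)))
          \<le> exp \<delta> * norm (real (card V) powr (- 1 / 2))"
        by (simp add: tilt_def mult.commute powr_minus_divide powr_half_sqrt)
    qed
  qed
qed

end
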